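(* Let $\mathcal S$ be an order $n$ linear discrete-time SISO system with transfer function $H(z)$, and let $(\mathbb U,\mathbb Y)$ be input-output data generated by $\mathcal S$. Let $\hat n\ge n$ and let $\sigma\in\mathbb C$ not be a pole of $\mathcal S$. If there exists $M_0\in\mathbb C$ such that $$\Sigma^{\hat n}_{(\mathbb U,\mathbb Y)}\subseteq\Sigma^{\hat n,0}_{\sigma,M_0},$$ then $M_0=H(\sigma)$.
   Context: System and data: the order $n$ system $\mathcal S$ has input/output behavior described by a difference equation $$y[t+n]+p_{n-1}y[t+n-1]+\cdots+p_0y[t]=q_nu[t+n]+q_{n-1}u[t+n-1]+\cdots+q_0u[t]$$ with real coefficients, and transfer function $H(z)=Q(z)/P(z)$ with $P(z)=z^n+p_{n-1}z^{n-1}+\cdots+p_0$ and $Q(z)=q_nz^n+\cdots+q_0$. The poles of $\mathcal S$ are the roots of $P$. Data generated by $\mathcal S$: $\mathbb U=[u[0],\dots,u[T]]^\top$ and $\mathbb Y=[y[0],\dots,y[T]]^\top$ in $\mathbb R^{T+1}$ are an input sequence and corresponding output sequence of $\mathcal S$, i.e. they satisfy the difference equation for $t=0,\dots,T-n$. It is assumed that $T\ge\hat n$. For an integer $N\ge 1$ with $T\ge N$: the Hankel matrix of depth $N$, $\mathbb H_N(\mathbb U)\in\mathbb R^{(N+1)\times(T-N+1)}$, has $(i,j)$ entry $u[i+j]$ for $0\le i\le N$, $0\le j\le T-N$; similarly $\mathbb H_N(\mathbb Y)$; and $\overline{\mathbb H}_N(\mathbb Y)\in\mathbb R^{N\times(T-N+1)}$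 is $\mathbb H_N(\mathbb Y)$ with the last row removed. Let $\gamma_k(\sigma)=[1,\sigma,\dots,\sigma^k]^\top\in\mathbb C^{k+1}$. Order $N$ systems explaining the data: $\Sigma^N_{(\mathbb U,\mathbb Y)}$ is the set of all $[\tilde{\mathbf q}\ \ -\tilde{\mathbf p}]\in\mathbb R^{1\times(2N+1)}$, with $\tilde{\mathbf q}\in\mathbb R^{1\times(N+1)}$ and $\tilde{\mathbf p}\in\mathbb R^{1\times N}$, such that $$[\tilde{\mathbf q}\ \ -\tilde{\mathbf p}]\begin{bmatrix}\mathbb H_N(\mathbb U)\\ \overline{\mathbb H}_N(\mathbb Y)\end{bmatrix}=[y[N]\ \ y[N+1]\ \cdots\ y[T]].$$ Order $N$ systems with zeroth moment $M_0$ at $\sigma$: $\Sigma^{N,0}_{\sigma,M_0}$ is the set of all $[\tilde{\mathbf q}\ \ -\tilde{\mathbf p}]\in\mathbb R^{1\times(2N+1)}$ such that $$[\tilde{\mathbf q}\ \ -\tilde{\mathbf p}]\begin{bmatrix}\gamma_N(\sigma)\\ M_0\gamma_{N-1}(\sigma)\end{bmatrix}=M_0\sigma^N.$$ *)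

theory Defs
  imports Complex_Main "HOL-Computational_Algebra.Polynomial" "Jordan_Normal_Form.Matrix"
begin

(* An order n system is given by its coefficient vectors p = [p_0, ..., p_{n-1}] in R^n and
   q = [q_0, ..., q_n] in R^{n+1}; the leading coefficient 1 of P is not stored. *)

definition den_poly :: "real vec \<Rightarrow> real poly" where
  "den_poly p = monom 1 (dim_vec p) + (\<Sum>i<dim_vec p. monom (p $ i) i)"

definition num_poly :: "real vec \<Rightarrow> real poly" where
  "num_poly q = (\<Sum>i<dim_vec q. monom (q $ i) i)"

definition is_system_pole :: "real vec \<Rightarrow> complex \<Rightarrow> bool" where
  "is_system_pole p z \<longleftrightarrow> poly (map_poly complex_of_real (den_poly p)) z = 0"

definition transfer_function :: "real vec \<Rightarrow> real vec \<Rightarrow> complex \<Rightarrow> complex" where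
  "transfer_function p q z =
     poly (map_poly complex_of_real (num_poly q)) z / poly (map_poly complex_of_real (den_poly p)) z"

definition is_system :: "nat \<Rightarrow> real vec \<Rightarrow> real vec \<Rightarrow> bool" where
  "is_system n p q \<longleftrightarrow> p \<in> carrier_vec n \<and> q \<in> carrier_vec (n + 1)"

(* The condition t + n <= T is t = 0, ..., T - n without truncated subtraction. *)
definition generated_data ::
  "nat \<Rightarrow> real vec \<Rightarrow> real vec \<Rightarrow> nat \<Rightarrow> real vec \<Rightarrow> real vec \<Rightarrow> bool" where
  "generated_data n p q T U Y \<longleftrightarrow>
     U \<in> carrier_vec (T + 1) \<and> Y \<in> carrier_vec (T + 1) \<and>
     (\<forall>t. t + n \<le> T \<longrightarrow>
        Y $ (t + n) + (\<Sum>i<n. p $ i * Y $ (t + i)) = (\<Sum>i\<le>n. q $ i * U $ (t + i)))"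

(* For data of length T + 1 with T >= N, the number of columns dim_vec x - N is T - N + 1. *)
definition hankel :: "nat \<Rightarrow> real vec \<Rightarrow> real mat" where
  "hankel N x = mat (N + 1) (dim_vec x - N) (\<lambda>(i, j). x $ (i + j))"

definition hankel_bar :: "nat \<Rightarrow> real vec \<Rightarrow> real mat" where
  "hankel_bar N x = mat N (dim_vec x - N) (\<lambda>(i, j). hankel N x $$ (i, j))"

definition gamma_vec :: "nat \<Rightarrow> complex \<Rightarrow> complex vec" where
  "gamma_vec k \<sigma> = vec (k + 1) (\<lambda>i. \<sigma> ^ i)"

(* The row vectors [q  -p] are represented by vectors of dimension 2N + 1. *)
definition explaining_systems :: "nat \<Rightarrow> real vec \<Rightarrow> real vec \<Rightarrow> real vec set" where
  "explaining_systems N U Y =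
     {q @\<^sub>v (- p) | q p. q \<in> carrier_vec (N + 1) \<and> p \<in> carrier_vec N \<and>
        mat_of_row (q @\<^sub>v (- p)) * (hankel N U @\<^sub>r hankel_bar N Y)
          = mat_of_row (vec (dim_vec Y - N) (\<lambda>j. Y $ (N + j)))}"

(* Used for N >= 1 only: for N = 0 the vector gamma_{N-1} would be empty, whereas N - 1
   truncates to 0. *)
definition moment_systems :: "nat \<Rightarrow> complex \<Rightarrow> complex \<Rightarrow> real vec set" where
  "moment_systems N \<sigma> M0 =
     {q @\<^sub>v (- p) | q p. q \<in> carrier_vec (N + 1) \<and> p \<in> carrier_vec N \<and>
        map_vec complex_of_real (q @\<^sub>v (- p)) \<bullet> (gamma_vec N \<sigma> @\<^sub>v (M0 \<cdot>\<^sub>v gamma_vec (N - 1) \<sigma>))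
          = M0 * \<sigma> ^ N}"

end

theory Submission
  imports Defs
begin

text \<open>The data are explained by any pair $(RP, RQ)$ with $R$ monic of degree \<open>nhat - n\<close>. Choosing
  $R(z) = (z - a)^{nhat - n}$ with $a$ real and $a \neq \sigma$, the moment condition for this system
  reads $M_0 R(\sigma) P(\sigma) = R(\sigma) Q(\sigma)$, where $R(\sigma) P(\sigma) \neq 0$. The
  obvious choice $a = 0$ (a pure time shift) would fail for $\sigma = 0$.\<close>

text \<open>The pair of polynomials replaces the coefficient vectors so that a common factor can be
  multiplied in. The degree bounds ensure that sums up to \<open>N\<close> see every coefficient,
  and \<open>coeff A N = 1\<close> records the monic leading term that the vectors leave
  out.\<close>

definition satisfies_recurrence ::
  "nat \<Rightarrow> real poly \<Rightarrow> real poly \<Rightarrow> nat \<Rightarrow> real vec \<Rightarrow> real vec \<Rightarrow> bool" where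
  "satisfies_recurrence N A B T U Y \<longleftrightarrow>
     degree A \<le> N \<and> coeff A N = 1 \<and> degree B \<le> N \<and>
     (\<forall>t. t + N \<le> T \<longrightarrow>
        (\<Sum>i\<le>N. coeff A i * Y $ (t + i)) = (\<Sum>i\<le>N. coeff B i * U $ (t + i)))"

lemma coeff_num_poly: "coeff (num_poly q) i = (if i < dim_vec q then q $ i else 0)"
  by (simp add: num_poly_def coeff_sum)

lemma coeff_den_poly:
  "coeff (den_poly p) i = (if i < dim_vec p then p $ i else if i = dim_vec p then 1 else 0)"
  by (auto simp: den_poly_def coeff_sum)

lemma satisfies_recurrence_system:
  assumes "is_system n p q" and "generated_data n p q T U Y"
  shows "satisfies_recurrence n (den_poly p) (num_poly q) T U Y"
proof -
  have dims: "dim_vec p = n" "dim_vec q = Suc n"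
    using assms(1) by (auto simp: is_system_def)
  have "(\<Sum>i\<le>n. coeff (den_poly p) i * Y $ (t + i)) = (\<Sum>i\<le>n. coeff (num_poly q) i * U $ (t + i))"
    if "t + n \<le> T" for t
  proof -
    have "(\<Sum>i\<le>n. coeff (den_poly p) i * Y $ (t + i)) = Y $ (t + n) + (\<Sum>i<n. p $ i * Y $ (t + i))"
      by (simp add: lessThan_Suc_atMost [symmetric] coeff_den_poly dims)
    also have "\<dots> = (\<Sum>i\<le>n. q $ i * U $ (t + i))"
      using assms(2) that by (simp add: generated_data_def)
    finally show ?thesis
      by (simp add: coeff_num_poly dims)
  qed
  then show ?thesis
    by (auto simp: satisfies_recurrence_def coeff_den_poly coeff_num_poly dims intro!: degree_le)
qed

text \<open>Pairing coefficients with a sequence \<open>f\<close> turns multiplication by the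
  variable into the forward shift of \<open>f\<close>, so the factor \<open>[:-a, 1:]\<close> acts
  as the shift minus \<open>a\<close> times the identity.\<close>

lemma sum_coeff_linear_factor:
  fixes A :: "'a::comm_ring_1 poly"
  assumes "degree A \<le> N"
  shows "(\<Sum>i\<le>Suc N. coeff ([:-a, 1:] * A) i * f i)
       = (\<Sum>i\<le>N. coeff A i * f (Suc i)) - a * (\<Sum>i\<le>N. coeff A i * f i)"
proof -
  have "coeff ([:-a, 1:] * A) i = coeff (pCons 0 A) i - a * coeff A i" for i
    by simp
  then have "(\<Sum>i\<le>Suc N. coeff ([:-a, 1:] * A) i * f i)
      = (\<Sum>i\<le>Suc N. coeff (pCons 0 A) i * f i) - a * (\<Sum>i\<le>Suc N. coeff A i * f i)"
    by (simp only: left_diff_distrib sum_subtractf sum_distrib_left mult.assoc)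
  \<comment> \<open>\<open>pCons 0 A\<close> is the variable times \<open>A\<close>: its constant
    term is 0, so the sum effectively starts at index 1.\<close>
  moreover have "(\<Sum>i\<le>Suc N. coeff (pCons 0 A) i * f i) = (\<Sum>i\<le>N. coeff A i * f (Suc i))"
    by (subst sum.atMost_Suc_shift) simp
  moreover have "(\<Sum>i\<le>Suc N. coeff A i * f i) = (\<Sum>i\<le>N. coeff A i * f i)"
    using assms by (simp add: coeff_eq_0)
  ultimately show ?thesis by simp
qed

text \<open>The new equation at time \<open>t\<close> is the old one at \<open>t + 1\<close> minus
  \<open>a\<close> times the old one at \<open>t\<close>. The range \<open>t + Suc N \<le> T\<close>
  is exactly where both old equations are available.\<close>

lemma satisfies_recurrence_linear_factor:
  assumes "satisfies_recurrence N A B T U Y"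
  shows "satisfies_recurrence (Suc N) ([:-a, 1:] * A) ([:-a, 1:] * B) T U Y"
proof -
  have A: "degree A \<le> N" "coeff A N = 1" and B: "degree B \<le> N"
    and rec: "\<And>t. t + N \<le> T \<Longrightarrow>
      (\<Sum>i\<le>N. coeff A i * Y $ (t + i)) = (\<Sum>i\<le>N. coeff B i * U $ (t + i))"
    using assms by (auto simp: satisfies_recurrence_def)
  have deg: "degree ([:-a, 1:] * C) \<le> Suc N" if "degree C \<le> N" for C
    using degree_mult_le [of "[:-a, 1:]" C] that by simp
  have "coeff ([:-a, 1:] * A) (Suc N) = 1"
    using A by (simp add: coeff_eq_0)
  moreover have "(\<Sum>i\<le>Suc N. coeff ([:-a, 1:] * A) i * Y $ (t + i))
      = (\<Sum>i\<le>Suc N. coeff ([:-a, 1:] * B) i * U $ (t + i))" if "t + Suc N \<le> T" for t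
    unfolding sum_coeff_linear_factor [OF A(1)] sum_coeff_linear_factor [OF B]
    using rec [of t] rec [of "Suc t"] that by simp
  ultimately show ?thesis
    unfolding satisfies_recurrence_def using deg A(1) B by blast
qed

lemma satisfies_recurrence_power:
  assumes "satisfies_recurrence N A B T U Y"
  shows "satisfies_recurrence (k + N) ([:-a, 1:] ^ k * A) ([:-a, 1:] ^ k * B) T U Y"
proof (induction k)
  case (Suc k)
  show ?case
    using satisfies_recurrence_linear_factor [OF Suc, of a]
    by (simp only: power_Suc mult.assoc add_Suc)
qed (use assms in simp)

text \<open>Column \<open>j\<close> of the stacked Hankel matrices holds the data window starting at
  time \<open>j\<close>, so entry \<open>j\<close> of the row equation is the recurrence at
  \<open>t = j\<close> solved for its leading output, which has coefficient 1.\<close>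

lemma explaining_systems_recurrence:
  assumes rec: "satisfies_recurrence N A B T U Y" and "N \<le> T"
    and "dim_vec U = Suc T" and "dim_vec Y = Suc T"
  shows "vec (Suc N) (coeff B) @\<^sub>v - vec N (coeff A) \<in> explaining_systems N U Y"
proof -
  let ?q = "vec (Suc N) (coeff B)" and ?p = "vec N (coeff A)"
  have "mat_of_row (?q @\<^sub>v - ?p) * (hankel N U @\<^sub>r hankel_bar N Y)
      = mat_of_row (vec (dim_vec Y - N) (\<lambda>j. Y $ (N + j)))" (is "?L = ?R")
  proof (rule eq_matI)
    show "dim_row ?L = dim_row ?R" by simp
    show dc: "dim_col ?L = dim_col ?R"
      using assms by (simp add: append_rows_def hankel_def)
    fix i j assume ij: "i < dim_row ?R" "j < dim_col ?R"
    then have j: "j < Suc T - N" using assms by simp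
    have col: "col (hankel N U @\<^sub>r hankel_bar N Y) j
        = vec (Suc N) (\<lambda>i. U $ (i + j)) @\<^sub>v vec N (\<lambda>i. Y $ (i + j))"
      using j assms
      by (intro eq_vecI) (auto simp: append_rows_def hankel_def hankel_bar_def)
    have "?L $$ (i, j) = (?q @\<^sub>v - ?p) \<bullet> col (hankel N U @\<^sub>r hankel_bar N Y) j"
      using ij dc by simp
    also have "\<dots> = ?q \<bullet> vec (Suc N) (\<lambda>i. U $ (i + j)) + (- ?p) \<bullet> vec N (\<lambda>i. Y $ (i + j))"
      unfolding col by (rule scalar_prod_append) auto
    also have "\<dots> = (\<Sum>i\<le>N. coeff B i * U $ (j + i)) - (\<Sum>i<N. coeff A i * Y $ (j + i))"
      by (simp add: scalar_prod_def lessThan_Suc_atMost [symmetric] lessThan_atLeast0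
          sum_negf add.commute)
    also have "(\<Sum>i\<le>N. coeff B i * U $ (j + i)) = (\<Sum>i\<le>N. coeff A i * Y $ (j + i))"
      using rec j assms(2) by (simp add: satisfies_recurrence_def)
    \<comment> \<open>Only the term \<open>i = N\<close> survives, and
      \<open>coeff A N = 1\<close>.\<close>
    also have "\<dots> - (\<Sum>i<N. coeff A i * Y $ (j + i)) = Y $ (N + j)"
      using rec by (simp add: satisfies_recurrence_def lessThan_Suc_atMost [symmetric] add.commute)
    finally show "?L $$ (i, j) = ?R $$ (i, j)"
      using ij by simp
  qed
  then show ?thesis
    unfolding explaining_systems_def
    by (intro CollectI exI [of _ ?q] exI [of _ ?p]) simp
qed

text \<open>Summing up to any bound \<open>N\<close> on the degree matches the fixed length of the
  moment vectors, even when the actual degree is smaller.\<close>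

lemma poly_map_of_real_altdef:
  fixes A :: "real poly" and z :: complex
  assumes "degree A \<le> N"
  shows "poly (map_poly of_real A) z = (\<Sum>i\<le>N. of_real (coeff A i) * z ^ i)"
proof -
  have "poly (map_poly of_real A) z = (\<Sum>i\<le>degree A. of_real (coeff A i) * z ^ i)"
    by (simp add: poly_altdef coeff_map_poly degree_map_poly)
  also have "\<dots> = (\<Sum>i\<le>N. of_real (coeff A i) * z ^ i)"
    using assms by (intro sum.mono_neutral_left) (auto simp: coeff_eq_0)
  finally show ?thesis .
qed

text \<open>The right-hand side \<open>M0 * \<sigma> ^ N\<close> of the moment condition is the
  contribution of the unstored leading coefficient of \<open>A\<close>. Moving the other terms in
  \<open>A\<close> next to it completes the value of \<open>A\<close> at \<sigma>.\<close>

lemma moment_systems_poly: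
  assumes mem: "vec (Suc N) (coeff B) @\<^sub>v - vec N (coeff A) \<in> moment_systems N \<sigma> M0"
    and "1 \<le> N" and A: "degree A \<le> N" "coeff A N = 1" and B: "degree B \<le> N"
  shows "poly (map_poly of_real B) \<sigma> = M0 * poly (map_poly of_real A) \<sigma>"
proof -
  let ?q = "vec (Suc N) (coeff B)" and ?p = "vec N (coeff A)"
  have split: "map_vec complex_of_real (?q @\<^sub>v - ?p)
      = vec (Suc N) (\<lambda>i. of_real (coeff B i)) @\<^sub>v vec N (\<lambda>i. - of_real (coeff A i))"
    by (intro eq_vecI) auto
  have "M0 * \<sigma> ^ N
      = map_vec complex_of_real (?q @\<^sub>v - ?p) \<bullet> (gamma_vec N \<sigma> @\<^sub>v (M0 \<cdot>\<^sub>v gamma_vec (N - 1) \<sigma>))"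
    using mem by (auto simp: moment_systems_def)
  also have "\<dots> = vec (Suc N) (\<lambda>i. of_real (coeff B i)) \<bullet> gamma_vec N \<sigma>
      + vec N (\<lambda>i. - of_real (coeff A i)) \<bullet> (M0 \<cdot>\<^sub>v gamma_vec (N - 1) \<sigma>)"
    \<comment> \<open>For \<open>N \<ge> 1\<close> the vector
      \<open>gamma_vec (N - 1) \<sigma>\<close> has exactly \<open>N\<close> entries, as many as the
      block of coefficients of \<open>A\<close>.\<close>
    unfolding split using \<open>1 \<le> N\<close> by (intro scalar_prod_append) (auto simp: gamma_vec_def)
  also have "\<dots> = (\<Sum>i\<le>N. of_real (coeff B i) * \<sigma> ^ i) - M0 * (\<Sum>i<N. of_real (coeff A i) * \<sigma> ^ i)"
    using \<open>1 \<le> N\<close>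
    by (simp add: scalar_prod_def gamma_vec_def lessThan_Suc_atMost [symmetric] lessThan_atLeast0
        sum_negf sum_distrib_left mult_ac)
  finally have "(\<Sum>i\<le>N. of_real (coeff B i) * \<sigma> ^ i) = M0 * (\<Sum>i\<le>N. of_real (coeff A i) * \<sigma> ^ i)"
    using A(2) by (simp add: lessThan_Suc_atMost [symmetric] algebra_simps)
  then show ?thesis
    using A(1) B by (simp add: poly_map_of_real_altdef)
qed

lemma map_poly_of_real_mult:
  fixes A B :: "real poly"
  shows "map_poly of_real (A * B)
    = (map_poly of_real A * map_poly of_real B :: 'a::{real_algebra_1,comm_ring_1} poly)"
  by (intro poly_eqI) (simp add: coeff_map_poly coeff_mult)

theorem lemma3p5:
  fixes n nhat T :: nat and p q U Y :: "real vec" and \<sigma> M0 :: complex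
  assumes "is_system n p q"
    and "1 \<le> nhat" and "n \<le> nhat" and "nhat \<le> T"
    and "generated_data n p q T U Y"
    and "\<not> is_system_pole p \<sigma>"
    and "explaining_systems nhat U Y \<subseteq> moment_systems nhat \<sigma> M0"
  shows "M0 = transfer_function p q \<sigma>"
proof -
  \<comment> \<open>The real parts of \<open>a\<close> and \<sigma> differ, so this works for real
    and non-real \<sigma> alike, and \<open>R\<close> keeps real coefficients.\<close>
  define a where "a = Re \<sigma> + 1"
  define R where "R = [:-a, 1:] ^ (nhat - n)"
  have "\<sigma> \<noteq> of_real a"
    by (auto simp: a_def complex_eq_iff)
  have rec: "satisfies_recurrence nhat (R * den_poly p) (R * num_poly q) T U Y"
    using satisfies_recurrence_power [OF satisfies_recurrence_system [OF assms(1,5)], of "nhat - n" a]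
      \<open>n \<le> nhat\<close> by (simp add: R_def)
  then have "vec (Suc nhat) (coeff (R * num_poly q)) @\<^sub>v - vec nhat (coeff (R * den_poly p))
      \<in> moment_systems nhat \<sigma> M0"
    using assms(4,5,7) explaining_systems_recurrence by (auto simp: generated_data_def)
  then have "poly (map_poly of_real (R * num_poly q)) \<sigma> = M0 * poly (map_poly of_real (R * den_poly p)) \<sigma>"
    using rec \<open>1 \<le> nhat\<close> by (intro moment_systems_poly) (auto simp: satisfies_recurrence_def)
  moreover have "poly (map_poly of_real R) \<sigma> = (\<sigma> - of_real a) ^ (nhat - n)"
    unfolding R_def
    by (induct ("nhat - n")) (simp_all only: power_0 power_Suc map_poly_of_real_mult poly_mult,
      simp_all add: map_poly_pCons)
  \<comment> \<open>The nonzero value of \<open>R\<close> at \<sigma> cancels from both sides;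
    dividing by the denominator is allowed because \<sigma> is not a pole.\<close>
  ultimately show ?thesis
    using \<open>\<sigma> \<noteq> of_real a\<close> assms(6)
    by (simp add: map_poly_of_real_mult transfer_function_def is_system_pole_def field_simps)
qed

end
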